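(* Let $k\ge1$ be an integer and $z$ an indeterminate. For every $n\ge 1$, in $\mathbb{Q}(z)$, $$\sum_{T\in T_k(n)}\prod_{h\in\mathcal{H}(T)}\frac{\prod_{i=1}^{h-1}(kh+z-i)}{kh\prod_{i=1}^{h-2}\big(kh+k(z-1)-i\big)}=\frac{z}{n!}\prod_{i=1}^{n-1}(kn+z-i).$$
   Context: A $k$-ary tree is an ordered rooted unlabeled tree in which every vertex has exactly $k$ subtrees in linear order, where a subtree is allowed to be empty; $T_k(n)$ is the set of $k$-ary trees with $n$ vertices. For a vertex $u$ of a tree $T$, the hook length $h_u$ is the number of descendants of $u$ (counting $u$ itself), and $\mathcal{H}(T)$ is the multiset of hook lengths of the vertices of $T$; the product over $\mathcal{H}(T)$ is the product over all vertices. Product convention: $\prod_{i=1}^{m}c_i$ is the ordinary product for $m\ge1$, equals $1$ for $m=0$, and for $m=-1$ equals $1/c_0$ where $c_0$ is the factor evaluated at $i=0$ (so for $h=1$, $\prod_{i=1}^{-1}(kh+k(z-1)-i)=1/(kz)$). *)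

theory Defs
  imports
    Complex_Main
    "HOL-Library.Multiset"
    "HOL-Library.Sublist"
    "HOL-Computational_Algebra.Polynomial_Factorial"
begin

datatype otree = Empty | Node "otree list"

fun is_kary :: "nat \<Rightarrow> otree \<Rightarrow> bool" where
  "is_kary k Empty \<longleftrightarrow> True"
| "is_kary k (Node ts) \<longleftrightarrow> length ts = k \<and> (\<forall>t\<in>set ts. is_kary k t)"

text \<open>A vertex is represented by the list of child indices on the path from the root to it;
  hence a vertex \<open>v\<close> is a descendant of \<open>u\<close> (possibly \<open>u\<close> itself) iff \<open>u\<close> is a prefix of \<open>v\<close>.\<close>

primrec vertices :: "otree \<Rightarrow> nat list set" where
  "vertices Empty = {}"
| "vertices (Node ts) = insert [] {i # p | i p. i < length ts \<and> p \<in> map vertices ts ! i}"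

definition hook_length :: "otree \<Rightarrow> nat list \<Rightarrow> nat" where
  "hook_length T u = card {v \<in> vertices T. prefix u v}"

definition hook_lengths :: "otree \<Rightarrow> nat multiset" where
  "hook_lengths T = image_mset (hook_length T) (mset_set (vertices T))"

definition kary_trees :: "nat \<Rightarrow> nat \<Rightarrow> otree set" where
  "kary_trees k n = {T. is_kary k T \<and> card (vertices T) = n}"

text \<open>The product of \<open>c 1, \<dots>, c m\<close>, extended to \<open>m = -1\<close> by \<open>1 / c 0\<close>, as forced by
  the recurrence \<open>ext_prod c m = ext_prod c (m - 1) * c m\<close> at \<open>m = 0\<close>. Values at \<open>m < -1\<close>
  carry no meaning.\<close>

definition ext_prod :: "(int \<Rightarrow> 'a :: field) \<Rightarrow> int \<Rightarrow> 'a" where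
  "ext_prod c m = (if m = - 1 then 1 / c 0 else \<Prod>i\<in>{1..m}. c i)"

definition Z :: "rat poly fract" where
  "Z = to_fract [:0, 1:]"

text \<open>Both \<open>mset_set\<close> and \<open>sum\<close> are degenerate on infinite sets; the next two facts show that
  neither degeneracy occurs.\<close>

lemma vertices_Node:
  "vertices (Node ts) = insert [] (\<Union>i<length ts. (#) i ` vertices (ts ! i))"
  by auto

lemma finite_vertices: "finite (vertices T)"
proof (induction T)
  case (Node ts)
  have "finite (vertices (ts ! i))" if "i < length ts" for i
    using Node that by simp
  then show ?case
    unfolding vertices_Node by blast
qed simp

lemma card_vertices_child:
  assumes "t \<in> set ts"
  shows "card (vertices t) < card (vertices (Node ts))"
proof -
  obtain i where i: "i < length ts" "t = ts ! i"
    using assms by (metis in_set_conv_nth)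
  have "(#) i ` vertices t \<subset> vertices (Node ts)"
    unfolding vertices_Node using i by blast
  then have "card ((#) i ` vertices t) < card (vertices (Node ts))"
    by (intro psubset_card_mono finite_vertices)
  then show ?thesis
    by (simp add: card_image)
qed

lemma finite_kary_trees: "finite (kary_trees k n)"
proof (induction n rule: less_induct)
  case (less n)
  let ?S = "\<Union>m<n. kary_trees k m"
  have "kary_trees k n \<subseteq> insert Empty (Node ` {ts. set ts \<subseteq> ?S \<and> length ts = k})"
  proof
    fix T assume T: "T \<in> kary_trees k n"
    show "T \<in> insert Empty (Node ` {ts. set ts \<subseteq> ?S \<and> length ts = k})"
    proof (cases T)
      case (Node ts)
      have "set ts \<subseteq> ?S"
      proof
        fix t assume "t \<in> set ts"
        then show "t \<in> ?S"
          using T Node card_vertices_child[of t ts] by (auto simp: kary_trees_def simp del: vertices.simps)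
      qed
      then show ?thesis
        using T Node by (auto simp: kary_trees_def)
    qed simp
  qed
  moreover have "finite ?S"
    using less by blast
  then have "finite {ts. set ts \<subseteq> ?S \<and> length ts = k}"
    by (rule finite_lists_length_eq)
  ultimately show ?case
    by (meson finite_imageI finite_insert finite_subset)
qed

end

theory Submission
  imports Defs "HOL-Computational_Algebra.Formal_Power_Series"
begin

unbundle fps_syntax

text \<open>The numbers \<open>A\<^sub>n(a) = a / n! * (\<Prod>i=1..n-1. k n + a - i)\<close> are the coefficients of \<open>B ^ a\<close>,
  where \<open>B = 1 + x B ^ k\<close>. Hence they satisfy the Rothe--Hagen convolution
  \<open>A(a) * A(b) = A(a + b)\<close>: as \<open>A\<^sub>n(a + 1) - A\<^sub>n(a) = A\<^sub>n\<^sub>-\<^sub>1(a + k)\<close>, it holds for natural \<open>a\<close> by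
  induction, and both sides are polynomials in \<open>a\<close>. Deleting the root of a tree leaves \<open>k\<close> trees
  whose generating function is by induction \<open>A(z) ^ k = A(k z)\<close>, and the
  denominator of the hook weight at \<open>h = n\<close> cancels \<open>A\<^sub>n\<^sub>-\<^sub>1(k z)\<close>.\<close>

section \<open>Rothe numbers, their convolution, and powers of their series\<close>

definition rothe :: "'a \<Rightarrow> 'a \<Rightarrow> nat \<Rightarrow> 'a :: field_char_0" where
  "rothe c a n = (if n = 0 then 1 else a / fact n * (\<Prod>i=1..<n. c * of_nat n + a - of_nat i))"

lemma rothe_0 [simp]: "rothe c a 0 = 1"
  by (simp add: rothe_def)

lemma rothe_zero: "n > 0 \<Longrightarrow> rothe c 0 n = 0"
  by (simp add: rothe_def)

text \<open>With X = c(n+1) + a, all three products share P = (X-1)...(X-(n-1)). The first has the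
  extra factor X, the second the extra factor X - n, and (a+1)X - a(X-n) = (n+1)(a+c) cancels one
  factor of (n+1)!.\<close>

lemma rothe_diff: "rothe c (a + 1) (Suc n) - rothe c a (Suc n) = rothe c (a + c) n"
proof (cases n)
  case 0
  then show ?thesis by (simp add: rothe_def)
next
  case (Suc m)
  define X where "X = c * of_nat (Suc n) + a"
  define P where "P = (\<Prod>i=1..<n. X - of_nat i)"
  have upper: "(\<Prod>i=1..<Suc n. c * of_nat (Suc n) + (a + 1) - of_nat i) = X * P"
  proof -
    have "(\<Prod>i=1..<Suc n. c * of_nat (Suc n) + (a + 1) - of_nat i) = (\<Prod>i=0..<n. X - of_nat i)"
      by (rule prod.reindex_bij_witness[of _ Suc "\<lambda>i. i - 1"])
        (auto simp: X_def of_nat_diff algebra_simps)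
    also have "\<dots> = X * P"
      using Suc by (simp add: P_def prod.atLeast_Suc_lessThan)
    finally show ?thesis .
  qed
  have lower: "(\<Prod>i=1..<Suc n. c * of_nat (Suc n) + a - of_nat i) = P * (X - of_nat n)"
    using Suc unfolding P_def X_def by (subst prod.atLeastLessThan_Suc) auto
  have shift: "(\<Prod>i=1..<n. c * of_nat n + (a + c) - of_nat i) = P"
    unfolding P_def X_def by (simp add: algebra_simps)
  have "rothe c (a + 1) (Suc n) - rothe c a (Suc n)
      = ((a + 1) * (X * P) - a * (P * (X - of_nat n))) / fact (Suc n)"
    unfolding rothe_def upper lower by (simp add: diff_divide_distrib)
  also have "(a + 1) * (X * P) - a * (P * (X - of_nat n)) = of_nat (Suc n) * ((a + c) * P)"
    by (simp add: X_def algebra_simps)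
  also have "\<dots> / fact (Suc n) = (a + c) * P / fact n"
    by (simp add: fact_Suc del: of_nat_Suc)
  also have "\<dots> = rothe c (a + c) n"
    using Suc by (simp add: rothe_def flip: shift)
  finally show ?thesis .
qed

definition rothe_poly :: "'a \<Rightarrow> nat \<Rightarrow> 'a :: field_char_0 poly" where
  "rothe_poly c n = (if n = 0 then 1
     else smult (1 / fact n) (pCons 0 (\<Prod>i=1..<n. [:c * of_nat n - of_nat i, 1:])))"

lemma poly_rothe_poly: "poly (rothe_poly c n) a = rothe c a n"
  by (simp add: rothe_poly_def rothe_def poly_prod algebra_simps)

text \<open>Carries the convolution from natural parameters to all of the field: characteristic 0
  gives infinitely many roots.\<close>

lemma poly_eq_0_if_of_nat_roots:
  fixes p :: "'a :: field_char_0 poly"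
  assumes "\<And>m. poly p (of_nat m) = 0"
  shows "p = 0"
proof (rule ccontr)
  assume "p \<noteq> 0"
  then have "finite {x. poly p x = 0}"
    by (rule poly_roots_finite)
  moreover have "range of_nat \<subseteq> {x. poly p x = 0}"
    using assms by auto
  ultimately show False
    using finite_subset infinite_UNIV_nat finite_imageD inj_of_nat by metis
qed

lemma rothe_convolution:
  "(\<Sum>j\<le>n. rothe c a j * rothe c b (n - j)) = rothe c (a + b) n"
proof (induction n arbitrary: a b)
  case 0
  show ?case by simp
next
  case (Suc n)
  \<comment> \<open>\<open>D\<close> is the defect of the identity as a function of the first
    parameter, \<open>b\<close> being fixed; \<open>p\<close> is the same defect as a
    polynomial.\<close>
  define D where "D x = (\<Sum>j\<le>Suc n. rothe c x j * rothe c b (Suc n - j)) - rothe c (x + b) (Suc n)" for x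
  define p where "p = (\<Sum>j\<le>Suc n. rothe_poly c j * [:rothe c b (Suc n - j):])
    - pcompose (rothe_poly c (Suc n)) [:b, 1:]"
  have p: "poly p x = D x" for x
    by (simp add: p_def D_def poly_sum poly_pcompose poly_rothe_poly add.commute mult.commute del: sum.atMost_Suc)
  have step: "D (x + 1) = D x" for x
  proof -
    have "D (x + 1) - D x
        = (\<Sum>j\<le>Suc n. (rothe c (x + 1) j - rothe c x j) * rothe c b (Suc n - j))
          - (rothe c (x + b + 1) (Suc n) - rothe c (x + b) (Suc n))"
      by (simp add: D_def sum_subtractf left_diff_distrib add.assoc add.commute[of 1] del: sum.atMost_Suc)
    also have "(\<Sum>j\<le>Suc n. (rothe c (x + 1) j - rothe c x j) * rothe c b (Suc n - j))
        = (\<Sum>j\<le>n. rothe c (x + c) j * rothe c b (n - j))"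
      \<comment> \<open>The term j = 0 vanishes because \<open>rothe\<close> is 1 there for every
        parameter; the other terms drop by one index.\<close>
      by (subst sum.atMost_Suc_shift) (simp add: rothe_diff)
    also have "\<dots> = rothe c (x + c + b) n"
      by (rule Suc.IH)
    also have "rothe c (x + c + b) n - (rothe c (x + b + 1) (Suc n) - rothe c (x + b) (Suc n)) = 0"
      unfolding rothe_diff by (simp add: add_ac)
    finally show ?thesis
      by simp
  qed
  have "D (of_nat m) = 0" for m
  proof (induction m)
    case 0
    show ?case
      unfolding D_def by (subst sum.atMost_Suc_shift) (simp add: rothe_zero)
  next
    case (Suc m)
    then show ?case
      using step[of "of_nat m"] by (simp add: add.commute)
  qed
  then have "p = 0"
    by (intro poly_eq_0_if_of_nat_roots) (simp add: p)
  then have "D a = 0"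
    by (simp flip: p)
  then show ?case
    by (simp add: D_def)
qed

lemma fps_rothe_power: "Abs_fps (rothe c a) ^ m = Abs_fps (rothe c (of_nat m * a))"
proof (induction m)
  case 0
  show ?case
    by (rule fps_ext) (simp add: rothe_zero)
next
  case (Suc m)
  then show ?case
    by (auto intro!: fps_ext simp: fps_mult_nth rothe_convolution atLeast0AtMost algebra_simps)
qed

text \<open>Lets a strong induction replace a series that is known only up to the index in
  question.\<close>

lemma fps_power_nth_cong:
  fixes f g :: "'a :: comm_ring_1 fps"
  assumes "\<And>i. i \<le> n \<Longrightarrow> f $ i = g $ i" and "i \<le> n"
  shows "(f ^ m) $ i = (g ^ m) $ i"
  using assms(2)
proof (induction m arbitrary: i)
  case (Suc m)
  then show ?case
    using assms(1) by (auto simp: fps_mult_nth intro!: sum.cong)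
qed simp

section \<open>Generating functions of forests\<close>

definition forests :: "nat \<Rightarrow> nat \<Rightarrow> nat \<Rightarrow> otree list set" where
  "forests k m n = {ts. length ts = m \<and> (\<forall>t\<in>set ts. is_kary k t) \<and>
     (\<Sum>t\<leftarrow>ts. card (vertices t)) = n}"

lemma finite_forests: "finite (forests k m n)"
proof (rule finite_subset)
  show "forests k m n \<subseteq> {ts. set ts \<subseteq> (\<Union>i\<le>n. kary_trees k i) \<and> length ts = m}"
    by (auto simp: forests_def kary_trees_def intro!: member_le_sum_list)
  show "finite {ts. set ts \<subseteq> (\<Union>i\<le>n. kary_trees k i) \<and> length ts = m}"
    by (intro finite_lists_length_eq finite_UN_I finite_kary_trees) auto
qed

text \<open>Splitting off the first tree and sorting by its size \<open>i\<close> turns the sum into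
  a Cauchy product.\<close>

lemma sum_forests:
  fixes w :: "otree \<Rightarrow> 'a :: comm_ring_1"
  shows "(\<Sum>ts\<in>forests k m n. \<Prod>t\<leftarrow>ts. w t) = (Abs_fps (\<lambda>i. \<Sum>t\<in>kary_trees k i. w t) ^ m) $ n"
proof (induction m arbitrary: n)
  case 0
  have "forests k 0 n = (if n = 0 then {[]} else {})"
    by (auto simp: forests_def)
  then show ?case by simp
next
  case (Suc m)
  let ?S = "Abs_fps (\<lambda>i. \<Sum>t\<in>kary_trees k i. w t)"
  have "(\<Sum>ts\<in>forests k (Suc m) n. \<Prod>t\<leftarrow>ts. w t)
      = (\<Sum>(i, t, ts)\<in>(SIGMA i:{..n}. kary_trees k i \<times> forests k m (n - i)). w t * (\<Prod>t\<leftarrow>ts. w t))"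
    by (rule sum.reindex_bij_witness[of _ "\<lambda>(i, t, ts). t # ts"
          "\<lambda>ts. (card (vertices (hd ts)), hd ts, tl ts)"])
      (auto simp: forests_def kary_trees_def length_Suc_conv)
  also have "\<dots> = (\<Sum>i\<le>n. \<Sum>(t, ts)\<in>kary_trees k i \<times> forests k m (n - i). w t * (\<Prod>t\<leftarrow>ts. w t))"
    by (subst sum.Sigma) (auto simp: finite_kary_trees finite_forests)
  also have "\<dots> = (\<Sum>i\<le>n. (\<Sum>t\<in>kary_trees k i. w t) * (\<Sum>ts\<in>forests k m (n - i). \<Prod>t\<leftarrow>ts. w t))"
    by (simp add: sum_product sum.cartesian_product)
  also have "\<dots> = (?S ^ Suc m) $ n"
    by (simp add: Suc.IH fps_mult_nth atLeast0AtMost)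
  finally show ?case .
qed

section \<open>Hook lengths and removal of the root\<close>

lemma prod_list_map_conv_prod_nth:
  fixes g :: "'b \<Rightarrow> 'a :: comm_monoid_mult"
  shows "(\<Prod>t\<leftarrow>ts. g t) = (\<Prod>i<length ts. g (ts ! i))"
  by (induction ts) (simp_all add: prod.lessThan_Suc_shift del: prod.lessThan_Suc)

lemma prod_vertices_Node:
  fixes g :: "nat list \<Rightarrow> 'a :: comm_monoid_mult"
  shows "(\<Prod>v\<in>vertices (Node ts). g v)
    = g [] * (\<Prod>i<length ts. \<Prod>v\<in>vertices (ts ! i). g (i # v))"
proof -
  have "(\<Prod>v\<in>vertices (Node ts). g v)
      = g [] * (\<Prod>v\<in>(\<Union>i<length ts. (#) i ` vertices (ts ! i)). g v)"
    unfolding vertices_Node by (rule prod.insert) (auto simp: finite_vertices)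
  also have "(\<Prod>v\<in>(\<Union>i<length ts. (#) i ` vertices (ts ! i)). g v)
      = (\<Prod>i<length ts. \<Prod>v\<in>(#) i ` vertices (ts ! i). g v)"
    by (rule prod.UNION_disjoint) (auto simp: finite_vertices)
  finally show ?thesis
    by (simp add: prod.reindex)
qed

lemma card_vertices_Node: "card (vertices (Node ts)) = Suc (\<Sum>t\<leftarrow>ts. card (vertices t))"
proof -
  have "card (vertices (Node ts)) = Suc (card (\<Union>i<length ts. (#) i ` vertices (ts ! i)))"
    unfolding vertices_Node by (rule card_insert_disjoint) (auto simp: finite_vertices)
  also have "card (\<Union>i<length ts. (#) i ` vertices (ts ! i))
      = (\<Sum>i<length ts. card ((#) i ` vertices (ts ! i)))"
    by (rule card_UN_disjoint) (auto simp: finite_vertices)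
  also have "\<dots> = (\<Sum>t\<leftarrow>ts. card (vertices t))"
    by (simp add: card_image sum_list_sum_nth atLeast0LessThan)
  finally show ?thesis .
qed

lemma hook_length_Nil: "hook_length T [] = card (vertices T)"
  by (simp add: hook_length_def)

text \<open>Every descendant of a vertex in the \<open>i\<close>-th subtree has a path that also
  starts with \<open>i\<close>, so it lies in that subtree.\<close>

lemma hook_length_Cons:
  assumes "i < length ts"
  shows "hook_length (Node ts) (i # p) = hook_length (ts ! i) p"
proof -
  have "{v \<in> vertices (Node ts). prefix (i # p) v} = (#) i ` {v \<in> vertices (ts ! i). prefix p v}"
    using assms by (auto simp: vertices_Node simp del: vertices.simps)
  then show ?thesis
    by (simp add: hook_length_def card_image)
qed

lemma prod_hook_lengths_Node:
  fixes f :: "nat \<Rightarrow> 'a :: comm_monoid_mult"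
  shows "(\<Prod>h\<in>#hook_lengths (Node ts). f h)
    = f (card (vertices (Node ts))) * (\<Prod>t\<leftarrow>ts. \<Prod>h\<in>#hook_lengths t. f h)"
proof -
  have vert: "(\<Prod>h\<in>#hook_lengths T. f h) = (\<Prod>v\<in>vertices T. f (hook_length T v))" for T
    by (simp add: hook_lengths_def prod_unfold_prod_mset image_mset.compositionality comp_def)
  show ?thesis
    unfolding vert prod_vertices_Node hook_length_Nil
    by (simp add: hook_length_Cons prod_list_map_conv_prod_nth del: vertices.simps)
qed

lemma kary_trees_0: "kary_trees k 0 = {Empty}"
proof -
  have "T = Empty" if "card (vertices T) = 0" for T
    using that by (cases T) (auto simp: card_vertices_Node simp del: vertices.simps(2))
  then show ?thesis
    by (auto simp: kary_trees_def)
qed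

text \<open>Empty subtrees are list entries without vertices, so deleting the root always leaves
  exactly \<open>k\<close> entries.\<close>

lemma kary_trees_Suc: "kary_trees k (Suc n) = Node ` forests k k n"
proof -
  have "T \<in> Node ` forests k k n" if "T \<in> kary_trees k (Suc n)" for T
    using that
    by (cases T) (auto simp: kary_trees_def forests_def card_vertices_Node simp del: vertices.simps(2))
  then show ?thesis
    by (auto simp: kary_trees_def forests_def card_vertices_Node simp del: vertices.simps)
qed

text \<open>The root's hook length is the size of the tree, so its factor is constant over the sum
  and comes out; the rest is multiplicative over the subtrees.\<close>

lemma sum_kary_trees_Suc:
  fixes f :: "nat \<Rightarrow> 'a :: comm_ring_1"
  defines "W \<equiv> \<lambda>T. \<Prod>h\<in>#hook_lengths T. f h"
  shows "(\<Sum>T\<in>kary_trees k (Suc n). W T)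
    = f (Suc n) * (Abs_fps (\<lambda>i. \<Sum>T\<in>kary_trees k i. W T) ^ k) $ n"
proof -
  have "(\<Sum>T\<in>kary_trees k (Suc n). W T) = (\<Sum>ts\<in>forests k k n. W (Node ts))"
    unfolding kary_trees_Suc by (simp add: sum.reindex inj_on_def)
  also have "\<dots> = (\<Sum>ts\<in>forests k k n. f (Suc n) * (\<Prod>t\<leftarrow>ts. W t))"
    unfolding W_def prod_hook_lengths_Node
    by (intro sum.cong) (auto simp: forests_def card_vertices_Node simp del: vertices.simps)
  finally show ?thesis
    by (simp add: sum_forests flip: sum_distrib_left)
qed

section \<open>Cancellation in the hook weight\<close>

lemma ext_prod_nat: "ext_prod c (int n) = (\<Prod>i=1..<Suc n. c (int i))"
proof -
  have "(\<Prod>i\<in>{1..int n}. c i) = (\<Prod>i=1..<Suc n. c (int i))"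
    by (rule prod.reindex_bij_witness[of _ int nat]) auto
  then show ?thesis
    by (simp add: ext_prod_def)
qed

text \<open>At h = n + 1 the base kh + k(z-1) equals kn + kz, so \<open>?D\<close> is the product
  inside \<open>rothe\<close> at kz and n. It cancels, as \<open>nonzero\<close> keeps its factors
  away from 0.\<close>

lemma hook_weight_mult_rothe:
  fixes z :: "'a :: field_char_0"
  assumes "k \<ge> 1" and nonzero: "\<And>m. of_nat k * z + of_int m \<noteq> 0"
  shows "ext_prod (\<lambda>i. of_nat k * of_nat (Suc n) + z - of_int i) (int (Suc n) - 1)
      / (of_nat k * of_nat (Suc n) *
         ext_prod (\<lambda>i. of_nat k * of_nat (Suc n) + of_nat k * (z - 1) - of_int i) (int (Suc n) - 2))
      * rothe (of_nat k) (of_nat k * z) n = rothe (of_nat k) z (Suc n)"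
    (is "?N / (_ * ?D) * _ = _")
proof -
  have N: "?N = (\<Prod>i=1..<Suc n. of_nat k * of_nat (Suc n) + z - of_nat i)"
    using ext_prod_nat[of "\<lambda>i. of_nat k * of_nat (Suc n) + z - of_int i" n] by simp
  have k: "of_nat k \<noteq> (0 :: 'a)"
    using assms(1) by simp
  have z: "z \<noteq> 0"
    using nonzero[of 0] by auto
  have D: "?D \<noteq> 0 \<and> rothe (of_nat k) (of_nat k * z) n = of_nat k * z / fact n * ?D"
  proof (cases n)
    case 0
    \<comment> \<open>Here h - 2 = -1, so \<open>?D\<close> is 1/(kz) by convention, which matches
      \<open>rothe\<close> being 1 at index 0.\<close>
    then show ?thesis
      using k z by (simp add: ext_prod_def algebra_simps)
  next
    case (Suc m)
    have "?D = (\<Prod>i=1..<n. of_nat k * of_nat n + of_nat k * z - of_nat i)"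
      using ext_prod_nat[of "\<lambda>i. of_nat k * of_nat (Suc n) + of_nat k * (z - 1) - of_int i" m] Suc
      by (simp add: algebra_simps)
    moreover have "of_nat k * of_nat n + of_nat k * z - of_nat i \<noteq> 0" for i
      using nonzero[of "int k * int n - int i"] by (simp add: algebra_simps)
    ultimately show ?thesis
      using Suc by (simp add: rothe_def)
  qed
  then show ?thesis
    using k by (simp add: N rothe_def fact_Suc del: of_nat_Suc)
qed

section \<open>The rational function field and the conclusion\<close>

lemma to_fract_of_nat: "to_fract (of_nat m) = of_nat m"
  by (induction m) simp_all

lemma to_fract_of_int: "to_fract (of_int m) = of_int m"
  by (cases m rule: int_cases2) (simp_all add: to_fract_of_nat)

text \<open>The fraction comes from a polynomial whose linear coefficient is \<open>k\<close>,
  whatever the constant term.\<close>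

lemma Z_nonzero:
  assumes "k \<ge> 1"
  shows "of_nat k * Z + of_int m \<noteq> 0"
proof -
  have "of_nat k * Z + of_int m = to_fract (of_nat k * [:0, 1:] + of_int m)"
    by (simp add: Z_def to_fract_of_nat to_fract_of_int
      del: mult_pCons_right of_nat_poly)
  moreover have "coeff (of_nat k * [:0, 1:] + of_int m :: rat poly) 1 \<noteq> 0"
    using assms by (simp add: of_nat_poly of_int_poly)
  ultimately show ?thesis
    by (metis coeff_0 to_fract_eq_0_iff)
qed

theorem theorem2p6:
  fixes k n :: nat
  assumes "k \<ge> 1" and "n \<ge> 1"
  shows "(\<Sum>T\<in>kary_trees k n. \<Prod>h\<in>#hook_lengths T.
            ext_prod (\<lambda>i. of_nat k * of_nat h + Z - of_int i) (int h - 1)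
            / (of_nat k * of_nat h *
               ext_prod (\<lambda>i. of_nat k * of_nat h + of_nat k * (Z - 1) - of_int i) (int h - 2)))
         = Z / fact n * ext_prod (\<lambda>i. of_nat k * of_nat n + Z - of_int i) (int n - 1)"
proof -
  define f where "f h = ext_prod (\<lambda>i. of_nat k * of_nat h + Z - of_int i) (int h - 1)
            / (of_nat k * of_nat h *
               ext_prod (\<lambda>i. of_nat k * of_nat h + of_nat k * (Z - 1) - of_int i) (int h - 2))" for h
  define S where "S i = (\<Sum>T\<in>kary_trees k i. \<Prod>h\<in>#hook_lengths T. f h)" for i
  have "S m = rothe (of_nat k) Z m" for m
  proof (induction m rule: less_induct)
    case (less m)
    show ?case
    proof (cases m)
      case 0
      then show ?thesis
        by (simp add: S_def kary_trees_0 hook_lengths_def)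
    next
      case (Suc l)
      have "S m = f m * (Abs_fps S ^ k) $ l"
        unfolding S_def Suc by (rule sum_kary_trees_Suc)
      also have "(Abs_fps S ^ k) $ l = (Abs_fps (rothe (of_nat k) Z) ^ k) $ l"
        \<comment> \<open>Only coefficients up to \<open>l\<close> < \<open>m\<close> enter, and
          these are covered by the induction hypothesis.\<close>
        by (rule fps_power_nth_cong[of l]) (auto simp: less Suc)
      also have "\<dots> = rothe (of_nat k) (of_nat k * Z) l"
        by (simp add: fps_rothe_power)
      also have "f m * \<dots> = rothe (of_nat k) Z m"
        unfolding f_def Suc using assms(1) by (intro hook_weight_mult_rothe Z_nonzero)
      finally show ?thesis .
    qed
  qed
  moreover have "rothe (of_nat k) Z n
      = Z / fact n * ext_prod (\<lambda>i. of_nat k * of_nat n + Z - of_int i) (int n - 1)"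
    using assms(2) ext_prod_nat[of "\<lambda>i. of_nat k * of_nat n + Z - of_int i" "n - 1"]
    by (simp add: rothe_def of_nat_diff)
  ultimately show ?thesis
    by (simp add: S_def f_def)
qed

end
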